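(* Consider a VRPSD instance under the optimal restocking (OR) policy. Let $S\subseteq N$ be nonempty, $E_S\subseteq E(S)$, and $m_{E_S}\in\{1,\dots,\bar m(E_S)\}$. With $\mathcal{L}^1_{E_S}$ the optimal value of the assignment problem defined in the context, $\mathcal{L}^1_{E_S}\le\bar{\mathcal{L}}(E_S,m_{E_S})$, i.e., $\mathcal{L}^1_{E_S}$ is a valid coefficient for the E-cut of $E_S$. In particular, for $E_S=E(S)$ and $m_{E_S}=m_S\in\{1,\dots,m(S)\}$, $\mathcal{L}^1_S:=\mathcal{L}^1_{E(S)}\le\mathcal{L}(S,m_S)$ is a valid coefficient for the S-cut of $S$.
   Context: **Instance.** Customers $N=\{1,\dots,n\}$, depot $0$, symmetric non-negative travel costs $c_{i,j}$ on $\{0\}\cup N$ satisfying the triangle inequality. $E(S)$ is the set of edges $\{i,j\}$ with $i\ne j\in S$. Demands $\xi_i$ are independent, supported in $\Xi_i\subseteq\mathbb{Z}_{\ge0}$, with finite means $\mu_i$; capacity $Q$ is a positive integer; load factor $f>0$, $\max_i\mu_i\le fQ$. Penalties $0\le b^P\le b^F$; $c^F_i=b^F+2c_{0,i}$; $c^P_{i,j}=b^P+c_{0,i}+c_{0,j}-c_{i,j}$ ($c^P_{0,j}=b^P$). A path is a nonempty sequence of distinct customers; $\mathcal{P}$ is the set of paths $p$ with $\sum_{i\in N(p)}\mu_i\le fQ$, where $N(p)$ is the customer set. **OR recourse.** $\Psi(s,q)=\max\{\lceil(s-q)/Q\rceil,0\}$. For $p=(i_1,\dots,i_t)$, $i_0=0$,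 $q\in\{0,\dots,Q\}$: $F^p_{i_t}(q)=0$; for $j<t$, $F^p_{i_j}(q)=\min\{H^p_{i_{j+1}}(q),c^P_{i_j,i_{j+1}}+H^p_{i_{j+1}}(Q)\}$ with $H^p_i(q)=\mathbb{E}[c^F_i\Psi(\xi_i,q)+F^p_i(\Psi(\xi_i,q)Q+q-\xi_i)]$. $\mathcal{Q}_p=\mathcal{Q}^{\text{OR}}_p$ is the minimum of $F^p_{i_0}(Q)$ over $p$ and its reversal. **Partitions.** $\Pi(S,m)$: sets of $m$ feasible paths whose customer sets partition $S$; $m(S)=\min\{m:\Pi(S,m)\neq\emptyset\}$; $\mathcal{L}(S,m)=\min_{\pi\in\Pi(S,m)}\sum_{p\in\pi}\mathcal{Q}_p$. $\bar\Pi(E_S,m)$: those $\pi\in\Pi(S,m)$ all of whose paths use only edges of $E_S$ (single-customer paths allowed); $\bar m(E_S)=\min\{m:\bar\Pi(E_S,m)\ne\emptyset\}$; $\bar{\mathcal{L}}(E_S,m)=\min_{\pi\in\bar\Pi(E_S,m)}\sum_{p\in\pi}\mathcal{Q}_p$. Minima over empty sets are $+\infty$. A valid coefficient of the E-cut $\sum_{i\in S}\theta_i\ge\mathcal{L}_{E_S}(\sum_{e\in E_S}x_e-|S|+m_{E_S}+1)$ is one with $\mathcal{L}_{E_S}\le\bar{\mathcal{L}}(E_S,m_{E_S})$; similarly for the S-cut $\sum_{i\in S}\theta_i\ge\mathcal{L}_S(\sum_{e\in E(S)}x_e-|S|+m_S+1)$ with $\mathcal{L}(S,m_S)$. **The bound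 $\mathcal{L}^1_{E_S}$.** Fix any indexing $i_1,\dots,i_{|S|}$ of $S$. For $k\in\{1,\dots,m_{E_S}\}$: $c^F_{(k)}=\min_{j\ge k}c^F_{i_j}$; $c^P_{(k)}=\min\{c^P_{i_j,i_\ell}:\{i_j,i_\ell\}\in E_S,\ j,\ell\ge k\}$ ($+\infty$ if there is none); $c^R_{(k)}=\min\{c^F_{(k)},c^P_{(k)}\}$. Let $\bar\mu>0$ be such that every $\mu_i$, $i\in S$, is an integer multiple of $\bar\mu$; $\bar D=\frac1{\bar\mu}\sum_{i\in S}\mu_i$; $\bar n=\lfloor fQ/\bar\mu\rfloor$. For each $d\in\{0,\bar\mu,\dots,\bar n\bar\mu\}$ let $\rho(d)\ge0$ satisfy $\rho(d)\le\mathbb{P}(\sum_{i\in S'}\xi_i>Q)$ for every $S'\subseteq S$ with $\sum_{i\in S'}\mu_i=d$, and $\rho(d)=0$ if no such $S'$ exists. Let $g_k(d)=\rho(d)\,c^R_{(k)}$. Then $$\mathcal{L}^1_{E_S}=\min\sum_{k=1}^{m_{E_S}}\sum_{\ell=0}^{\bar n}g_k(\ell\bar\mu)y_{k\ell}$$ over $y_{k\ell}\in\{0,1\}$ with $\sum_{\ell=0}^{\bar n}y_{k\ell}=1$ for each $k$ and $\sum_{k}\sum_{\ell}\ell\,y_{k\ell}=\bar D$ ($+\infty$ if infeasible). *)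

theory Defs
  imports "HOL-Probability.Probability"
begin

section \<open>VRPSD instances\<close>

text \<open>
  Customers are \<open>1, \<dots>, n\<close> and the depot is \<open>0\<close>. Demands are random variables on a common
  probability space. They take natural numbers as values; a customer's set of possible demands is
  an arbitrary set of naturals and imposes no further restriction.
\<close>

record 'a vrpsd =
  ncust :: nat
  cost :: "nat \<Rightarrow> nat \<Rightarrow> real"
  pspace :: "'a measure"
  demand :: "nat \<Rightarrow> 'a \<Rightarrow> nat"
  cap :: nat
  load :: real
  penP :: real
  penF :: real

definition customers :: "'a vrpsd \<Rightarrow> nat set" where
  "customers I = {1..ncust I}"

definition mean :: "'a vrpsd \<Rightarrow> nat \<Rightarrow> real" where
  "mean I i = (\<integral>\<omega>. real (demand I i \<omega>) \<partial>pspace I)"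

text \<open>
  The diagonal of the cost matrix is never used, so nothing is assumed about it.
\<close>

locale vrpsd_instance = prob_space "pspace I" for I :: "'a vrpsd" +
  assumes cost_sym:
      "\<And>i j. \<lbrakk>i \<le> ncust I; j \<le> ncust I\<rbrakk> \<Longrightarrow> cost I i j = cost I j i"
    and cost_nonneg:
      "\<And>i j. \<lbrakk>i \<le> ncust I; j \<le> ncust I; i \<noteq> j\<rbrakk> \<Longrightarrow> 0 \<le> cost I i j"
    and cost_triangle:
      "\<And>i j k. \<lbrakk>i \<le> ncust I; j \<le> ncust I; k \<le> ncust I; i \<noteq> j; j \<noteq> k; i \<noteq> k\<rbrakk>
        \<Longrightarrow> cost I i k \<le> cost I i j + cost I j k"
    and demand_indep: "indep_vars (\<lambda>_. count_space UNIV) (demand I) (customers I)"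
    and demand_integrable:
      "\<And>i. i \<in> customers I \<Longrightarrow> integrable (pspace I) (\<lambda>\<omega>. real (demand I i \<omega>))"
    and cap_pos: "0 < cap I"
    and load_pos: "0 < load I"
    and mean_le: "\<And>i. i \<in> customers I \<Longrightarrow> mean I i \<le> load I * real (cap I)"
    and penP_nonneg: "0 \<le> penP I"
    and penP_le_penF: "penP I \<le> penF I"

section \<open>Optimal restocking recourse\<close>

definition cF :: "'a vrpsd \<Rightarrow> nat \<Rightarrow> real" where
  "cF I i = penF I + 2 * cost I 0 i"

definition cP :: "'a vrpsd \<Rightarrow> nat \<Rightarrow> nat \<Rightarrow> real" where
  "cP I i j = (if i = 0 then penP I else penP I + cost I 0 i + cost I 0 j - cost I i j)"

definition Psi :: "nat \<Rightarrow> int \<Rightarrow> int \<Rightarrow> int" where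
  "Psi Q s q = max \<lceil>real_of_int (s - q) / real Q\<rceil> 0"

text \<open>
  The value functions at a customer \<open>i\<close> of a path depend only on the part of the path that starts
  at \<open>i\<close>, so they are indexed by that suffix: \<open>F_OR I (i # p)\<close> is the expected cost-to-go after
  \<open>i\<close> has been served, and \<open>H_OR I (i # p)\<close> the one before the demand of \<open>i\<close> is observed, with
  the vehicle at \<open>i\<close>. The values at the empty list are never used. The vehicle load \<open>q\<close> always
  stays in \<open>{0..Q}\<close>, hence \<open>F_OR\<close> takes finitely many values there and, demands having finite
  means, every integrand below is integrable.
\<close>

fun F_OR :: "'a vrpsd \<Rightarrow> nat list \<Rightarrow> int \<Rightarrow> real"
  and H_OR :: "'a vrpsd \<Rightarrow> nat list \<Rightarrow> int \<Rightarrow> real" where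
  "F_OR I [] q = 0"
| "F_OR I [i] q = 0"
| "F_OR I (i # j # p) q =
     min (H_OR I (j # p) q) (cP I i j + H_OR I (j # p) (int (cap I)))"
| "H_OR I [] q = 0"
| "H_OR I (i # p) q =
     (\<integral>\<omega>. cF I i * real_of_int (Psi (cap I) (int (demand I i \<omega>)) q)
        + F_OR I (i # p) (Psi (cap I) (int (demand I i \<omega>)) q * int (cap I)
                           + q - int (demand I i \<omega>)) \<partial>pspace I)"

definition recourse_OR :: "'a vrpsd \<Rightarrow> nat list \<Rightarrow> real" where
  "recourse_OR I p =
     min (F_OR I (0 # p) (int (cap I))) (F_OR I (0 # rev p) (int (cap I)))"

section \<open>Paths and partitions\<close>

definition feasible_path :: "'a vrpsd \<Rightarrow> nat list \<Rightarrow> bool" where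
  "feasible_path I p \<longleftrightarrow>
     p \<noteq> [] \<and> distinct p \<and> set p \<subseteq> customers I \<and>
     (\<Sum>i\<in>set p. mean I i) \<le> load I * real (cap I)"

definition all_edges_on :: "nat set \<Rightarrow> nat set set" where
  "all_edges_on S = {{i, j} | i j. i \<in> S \<and> j \<in> S \<and> i \<noteq> j}"

text \<open>Depot edges are not counted, so a single-customer path has no edges.\<close>

definition path_edges :: "nat list \<Rightarrow> nat set set" where
  "path_edges p = {{p ! j, p ! Suc j} | j. Suc j < length p}"

definition path_partitions :: "'a vrpsd \<Rightarrow> nat set \<Rightarrow> nat \<Rightarrow> nat list set set" where
  "path_partitions I S m =
     {\<pi>. finite \<pi> \<and> card \<pi> = m \<and> (\<forall>p\<in>\<pi>. feasible_path I p) \<and>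
         disjoint_family_on set \<pi> \<and> (\<Union>p\<in>\<pi>. set p) = S}"

definition path_partitions_E ::
    "'a vrpsd \<Rightarrow> nat set \<Rightarrow> nat set set \<Rightarrow> nat \<Rightarrow> nat list set set" where
  "path_partitions_E I S E m =
     {\<pi> \<in> path_partitions I S m. \<forall>p\<in>\<pi>. path_edges p \<subseteq> E}"

text \<open>
  Minima are taken as infima in \<^typ>\<open>enat\<close> and \<^typ>\<open>ereal\<close>, so that the empty minimum is \<open>\<infinity>\<close>;
  all infima below range over finitely many values or over sets of naturals.
\<close>

definition min_paths :: "'a vrpsd \<Rightarrow> nat set \<Rightarrow> enat" where
  "min_paths I S = (INF m\<in>{m. path_partitions I S m \<noteq> {}}. enat m)"

definition min_paths_E :: "'a vrpsd \<Rightarrow> nat set \<Rightarrow> nat set set \<Rightarrow> enat" where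
  "min_paths_E I S E = (INF m\<in>{m. path_partitions_E I S E m \<noteq> {}}. enat m)"

definition min_recourse :: "'a vrpsd \<Rightarrow> nat set \<Rightarrow> nat \<Rightarrow> ereal" where
  "min_recourse I S m =
     (INF \<pi>\<in>path_partitions I S m. ereal (\<Sum>p\<in>\<pi>. recourse_OR I p))"

definition min_recourse_E :: "'a vrpsd \<Rightarrow> nat set \<Rightarrow> nat set set \<Rightarrow> nat \<Rightarrow> ereal" where
  "min_recourse_E I S E m =
     (INF \<pi>\<in>path_partitions_E I S E m. ereal (\<Sum>p\<in>\<pi>. recourse_OR I p))"

definition valid_S_cut_coeff :: "'a vrpsd \<Rightarrow> nat set \<Rightarrow> nat \<Rightarrow> ereal \<Rightarrow> bool" where
  "valid_S_cut_coeff I S m L \<longleftrightarrow> L \<le> min_recourse I S m"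

definition valid_E_cut_coeff ::
    "'a vrpsd \<Rightarrow> nat set \<Rightarrow> nat set set \<Rightarrow> nat \<Rightarrow> ereal \<Rightarrow> bool" where
  "valid_E_cut_coeff I S E m L \<longleftrightarrow> L \<le> min_recourse_E I S E m"

section \<open>The assignment bound\<close>

text \<open>The indexing of \<open>S\<close> is a bijection \<open>idx\<close> from \<open>{1..card S}\<close> onto \<open>S\<close>.\<close>

definition cF_from :: "'a vrpsd \<Rightarrow> nat set \<Rightarrow> (nat \<Rightarrow> nat) \<Rightarrow> nat \<Rightarrow> ereal" where
  "cF_from I S idx k = (INF j\<in>{k..card S}. ereal (cF I (idx j)))"

definition cP_from ::
    "'a vrpsd \<Rightarrow> nat set \<Rightarrow> nat set set \<Rightarrow> (nat \<Rightarrow> nat) \<Rightarrow> nat \<Rightarrow> ereal" where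
  "cP_from I S E idx k =
     (INF (j, l)\<in>{(j, l). j \<in> {k..card S} \<and> l \<in> {k..card S} \<and> {idx j, idx l} \<in> E}.
        ereal (cP I (idx j) (idx l)))"

definition cR_from ::
    "'a vrpsd \<Rightarrow> nat set \<Rightarrow> nat set set \<Rightarrow> (nat \<Rightarrow> nat) \<Rightarrow> nat \<Rightarrow> ereal" where
  "cR_from I S E idx k = min (cF_from I S idx k) (cP_from I S E idx k)"

definition mean_unit :: "'a vrpsd \<Rightarrow> nat set \<Rightarrow> real \<Rightarrow> bool" where
  "mean_unit I S u \<longleftrightarrow> 0 < u \<and> (\<forall>i\<in>S. \<exists>z::int. mean I i = of_int z * u)"

definition total_units :: "'a vrpsd \<Rightarrow> nat set \<Rightarrow> real \<Rightarrow> real" where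
  "total_units I S u = (1 / u) * (\<Sum>i\<in>S. mean I i)"

definition max_units :: "'a vrpsd \<Rightarrow> real \<Rightarrow> nat" where
  "max_units I u = nat \<lfloor>load I * real (cap I) / u\<rfloor>"

definition overflow_prob :: "'a vrpsd \<Rightarrow> nat set \<Rightarrow> real" where
  "overflow_prob I T =
     measure (pspace I) {\<omega> \<in> space (pspace I). (\<Sum>i\<in>T. demand I i \<omega>) > cap I}"

definition overflow_bound :: "'a vrpsd \<Rightarrow> nat set \<Rightarrow> real \<Rightarrow> (real \<Rightarrow> real) \<Rightarrow> bool" where
  "overflow_bound I S u \<rho> \<longleftrightarrow>
     (\<forall>d\<in>{real l * u | l. l \<le> max_units I u}.
        0 \<le> \<rho> d \<and>
        (\<forall>T. T \<subseteq> S \<and> (\<Sum>i\<in>T. mean I i) = d \<longrightarrow> \<rho> d \<le> overflow_prob I T) \<and>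
        ((\<nexists>T. T \<subseteq> S \<and> (\<Sum>i\<in>T. mean I i) = d) \<longrightarrow> \<rho> d = 0))"

definition assignments ::
    "'a vrpsd \<Rightarrow> nat set \<Rightarrow> nat \<Rightarrow> real \<Rightarrow> (nat \<Rightarrow> nat \<Rightarrow> nat) set" where
  "assignments I S m u =
     {y. (\<forall>k\<in>{1..m}. \<forall>l\<in>{0..max_units I u}. y k l \<in> {0, 1}) \<and>
         (\<forall>k\<in>{1..m}. (\<Sum>l=0..max_units I u. y k l) = 1) \<and>
         real (\<Sum>k=1..m. \<Sum>l=0..max_units I u. l * y k l) = total_units I S u}"

definition L1 ::
    "'a vrpsd \<Rightarrow> nat set \<Rightarrow> nat set set \<Rightarrow> nat \<Rightarrow> (nat \<Rightarrow> nat) \<Rightarrow> real \<Rightarrow> (real \<Rightarrow> real) \<Rightarrow> ereal"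
  where
  "L1 I S E m idx u \<rho> =
     (INF y\<in>assignments I S m u.
        \<Sum>k=1..m. \<Sum>l=0..max_units I u.
          (ereal (\<rho> (real l * u)) * cR_from I S E idx k) * ereal (real (y k l)))"

end

theory Submission
  imports Defs
begin

text \<open>
  An induction along a path shows that its recourse cost dominates the probability that the total
  demand of the path exceeds the capacity, times the cheapest failure or preventive restocking
  cost that can occur on the path. Order the paths of a partition by their smallest index in the
  indexing of \<open>S\<close>. The \<open>k\<close>-th path then only visits customers of index at least \<open>k\<close>, so that
  this cheapest cost is at least \<open>cR_from I S E idx k\<close>, and assigning to \<open>k\<close> the total mean
  demand of the \<open>k\<close>-th path yields a feasible solution of the assignment problem.
\<close>

section \<open>Ranking by distinct positive labels\<close>

text \<open>The k-th smallest of distinct positive integers is at least k. It is applied to the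
  paths of a partition, labelled by their smallest index.\<close>

lemma ex_bij_betw_rank_le:
  fixes a :: "'b \<Rightarrow> nat"
  assumes "finite A" and "inj_on a A" and "\<And>x. x \<in> A \<Longrightarrow> 1 \<le> a x"
  shows "\<exists>e. bij_betw e {1..card A} A \<and> (\<forall>k\<in>{1..card A}. k \<le> a (e k))"
proof -
  \<comment> \<open>\<open>r x\<close> is the rank of \<open>x\<close> by label; the enumeration
    sought is the inverse of \<open>r\<close>.\<close>
  define r where "r x = card {y \<in> A. a y \<le> a x}" for x
  have less: "r x < r y" if "x \<in> A" "y \<in> A" "a x < a y" for x y
  proof -
    have "y \<in> {z \<in> A. a z \<le> a y}" "y \<notin> {z \<in> A. a z \<le> a x}" using that by auto
    moreover have "{z \<in> A. a z \<le> a x} \<subseteq> {z \<in> A. a z \<le> a y}" using that by auto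
    ultimately have "{z \<in> A. a z \<le> a x} \<subset> {z \<in> A. a z \<le> a y}" by blast
    then show ?thesis unfolding r_def using assms(1) by (intro psubset_card_mono) auto
  qed
  have inj: "inj_on r A"
    by (metis (no_types, lifting) assms(2) inj_on_def less less_irrefl linorder_less_linear)
  have sub: "r ` A \<subseteq> {1..card A}"
  proof
    fix k assume "k \<in> r ` A"
    then obtain x where x: "x \<in> A" "k = r x" by auto
    then have "card {y \<in> A. a y \<le> a x} > 0" using assms(1) by (auto simp: card_gt_0_iff)
    moreover have "card {y \<in> A. a y \<le> a x} \<le> card A" using assms(1) by (intro card_mono) auto
    ultimately show "k \<in> {1..card A}" using x by (simp add: r_def)
  qed
  have "r ` A = {1..card A}"
    using sub inj by (intro card_subset_eq) (auto simp: card_image)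
  with inj have bij: "bij_betw r A {1..card A}" by (simp add: bij_betw_def)
  \<comment> \<open>The \<open>r x\<close> elements counted have distinct labels in
    \<open>{1..a x}\<close>.\<close>
  have rank: "r x \<le> a x" if "x \<in> A" for x
  proof -
    have "card {y \<in> A. a y \<le> a x} \<le> card {1..a x}"
      by (rule card_inj_on_le[of a]) (use assms in \<open>auto intro: inj_on_subset\<close>)
    then show ?thesis by (simp add: r_def)
  qed
  have "k \<le> a (inv_into A r k)" if "k \<in> {1..card A}" for k
    using that bij rank[of "inv_into A r k"]
    by (metis bij_betw_imp_surj_on f_inv_into_f inv_into_into)
  with bij_betw_inv_into[OF bij] show ?thesis by blast
qed

section \<open>Number of failures and load after refilling\<close>

lemma Psi_eq_0:
  assumes "s \<le> q"
  shows "Psi Q s q = 0"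
proof -
  have "real_of_int (s - q) / real Q \<le> 0"
    using assms by (simp add: divide_nonpos_nonneg)
  then have "\<lceil>real_of_int (s - q) / real Q\<rceil> \<le> 0" by (simp add: ceiling_le_zero)
  then show ?thesis by (simp add: Psi_def)
qed

lemma Psi_ge_1:
  assumes "q < s" and "0 < Q"
  shows "1 \<le> Psi Q s q"
proof -
  have "0 < real_of_int (s - q) / real Q" using assms by simp
  then have "1 \<le> \<lceil>real_of_int (s - q) / real Q\<rceil>" by linarith
  then show ?thesis by (simp add: Psi_def)
qed

lemma Psi_nonneg: "0 \<le> Psi Q s q"
  by (simp add: Psi_def)

text \<open>A crude bound, but enough for integrability: the number of refills is dominated by the
  demand, which has finite mean.\<close>

lemma Psi_le:
  assumes "0 \<le> q" and "0 \<le> s" and "0 < Q"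
  shows "Psi Q s q \<le> s"
proof -
  have "real_of_int (s - q) \<le> real_of_int s * real Q"
  proof -
    have "real_of_int (s - q) \<le> real_of_int s * 1" using assms by simp
    also have "\<dots> \<le> real_of_int s * real Q" using assms by (intro mult_left_mono) auto
    finally show ?thesis .
  qed
  then have "real_of_int (s - q) / real Q \<le> real_of_int s"
    using assms by (simp add: divide_le_eq)
  then show ?thesis using assms by (simp add: Psi_def ceiling_le_iff)
qed

text \<open>In a shortage, put x = (s - q) / Q and multiply x \<le> ceiling of x \<le> x + 1 by Q.
  The value functions are thus only evaluated on a finite range of loads.\<close>

lemma restocked_load_bounds:
  assumes "0 \<le> q" and "q \<le> int Q" and "0 \<le> s" and "0 < Q"
  shows "Psi Q s q * int Q + q - s \<in> {0..int Q}"
proof (cases "s \<le> q")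
  case True
  then show ?thesis using assms by (simp add: Psi_eq_0)
next
  case False
  define x where "x = real_of_int (s - q) / real Q"
  have "Psi Q s q = \<lceil>x\<rceil>" using Psi_ge_1[of q s Q] False assms by (auto simp: Psi_def x_def)
  moreover have xQ: "x * real Q = real_of_int (s - q)" using assms by (simp add: x_def)
  have "x * real Q \<le> real_of_int \<lceil>x\<rceil> * real Q"
    by (intro mult_right_mono) auto
  moreover have "real_of_int \<lceil>x\<rceil> * real Q \<le> (x + 1) * real Q"
    by (intro mult_right_mono) (linarith, simp)
  ultimately have "real_of_int (s - q) \<le> real_of_int (Psi Q s q * int Q)"
    "real_of_int (Psi Q s q * int Q) \<le> real_of_int (s - q + int Q)"
    using xQ by (auto simp: algebra_simps)
  then have "s - q \<le> Psi Q s q * int Q" "Psi Q s q * int Q \<le> s - q + int Q"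
    unfolding of_int_le_iff by auto
  then show ?thesis by simp
qed

section \<open>Demands, costs and overflow probabilities\<close>

lemma measurable_count_space_sum:
  fixes f :: "'i \<Rightarrow> 'b \<Rightarrow> nat"
  assumes "finite A" and "\<And>i. i \<in> A \<Longrightarrow> f i \<in> M \<rightarrow>\<^sub>M count_space UNIV"
  shows "(\<lambda>x. \<Sum>i\<in>A. f i x) \<in> M \<rightarrow>\<^sub>M count_space UNIV"
  using assms
proof (induction A rule: finite_induct)
  case (insert i A)
  have [measurable]: "f i \<in> M \<rightarrow>\<^sub>M count_space UNIV"
    "(\<lambda>x. \<Sum>i\<in>A. f i x) \<in> M \<rightarrow>\<^sub>M count_space UNIV"
    using insert by auto
  show ?case using insert by simp
qed simp

context vrpsd_instance
begin

lemma demand_measurable: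
  "i \<in> customers I \<Longrightarrow> demand I i \<in> pspace I \<rightarrow>\<^sub>M count_space UNIV"
  using demand_indep by (auto simp: indep_vars_def2)

lemma mean_nonneg: "0 \<le> mean I i"
  by (simp add: mean_def)

lemma cF_nonneg: "i \<in> customers I \<Longrightarrow> 0 \<le> cF I i"
  using cost_nonneg[of 0 i] penP_nonneg penP_le_penF by (auto simp: cF_def customers_def)

text \<open>By the triangle inequality, the detour from \<open>i\<close> to \<open>j\<close> through
  the depot is no shorter than the direct trip.\<close>

lemma cP_nonneg: "\<lbrakk>i \<in> customers I; j \<in> customers I; i \<noteq> j\<rbrakk> \<Longrightarrow> 0 \<le> cP I i j"
  using cost_triangle[of i 0 j] cost_sym[of i 0] penP_nonneg
  by (auto simp: cP_def customers_def)

text \<open>Condition on the demand of \<open>i\<close>: it exceeds \<open>q\<close> by itself, or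
  it equals some x \<le> q and the rest must exceed q - x. Independence turns the joint
  probabilities into products. This matches the recursion of \<open>H_OR\<close>, where q - x is the
  load left after serving \<open>i\<close>.\<close>

lemma overflow_split:
  assumes "i \<in> customers I" and "A \<subseteq> customers I" and "finite A" and "i \<notin> A"
  shows "prob {\<omega> \<in> space (pspace I). q < (\<Sum>j\<in>insert i A. demand I j \<omega>)} =
    prob {\<omega> \<in> space (pspace I). q < demand I i \<omega>} +
    (\<Sum>x\<le>q. prob {\<omega> \<in> space (pspace I). demand I i \<omega> = x} *
             prob {\<omega> \<in> space (pspace I). q - x < (\<Sum>j\<in>A. demand I j \<omega>)})"
proof -
  let ?M = "pspace I"
  define Y where "Y = (\<lambda>\<omega>. \<Sum>j\<in>A. demand I j \<omega>)"
  have [measurable]: "demand I i \<in> ?M \<rightarrow>\<^sub>M count_space UNIV"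
    using assms demand_measurable by simp
  have [measurable]: "Y \<in> ?M \<rightarrow>\<^sub>M count_space UNIV"
    unfolding Y_def using assms demand_measurable 
    by (intro measurable_count_space_sum) auto
  have "indep_vars (\<lambda>_. count_space UNIV) (demand I) (insert i A)"
    by (rule indep_vars_subset[OF demand_indep]) (use assms in auto)
  \<comment> \<open>The cast to reals puts the demands into the form of
    \<open>indep_vars_sum\<close>, which separates \<open>i\<close> from the sum over
    \<open>A\<close>.\<close>
  then have "indep_vars (\<lambda>_. borel) (\<lambda>j \<omega>. real (demand I j \<omega>)) (insert i A)"
    by (rule indep_vars_compose2[where Y = "\<lambda>_. real"]) simp
  then have "indep_var borel (\<lambda>\<omega>. real (demand I i \<omega>)) borel (\<lambda>\<omega>. \<Sum>j\<in>A. real (demand I j \<omega>))"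
    using assms by (intro indep_vars_sum) auto
  then have indep: "indep_var borel (\<lambda>\<omega>. real (demand I i \<omega>)) borel (\<lambda>\<omega>. real (Y \<omega>))"
    by (simp add: Y_def)
  have prod: "prob {\<omega> \<in> space ?M. demand I i \<omega> = x \<and> r < Y \<omega>} =
      prob {\<omega> \<in> space ?M. demand I i \<omega> = x} * prob {\<omega> \<in> space ?M. r < Y \<omega>}" for x r
  proof -
    have "prob ((\<lambda>\<omega>. (real (demand I i \<omega>), real (Y \<omega>))) -` ({real x} \<times> {real r<..}) \<inter> space ?M) =
      prob ((\<lambda>\<omega>. real (demand I i \<omega>)) -` {real x} \<inter> space ?M) *
      prob ((\<lambda>\<omega>. real (Y \<omega>)) -` {real r<..} \<inter> space ?M)"
      by (rule indep_varD[OF indep]) auto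
    moreover have "(\<lambda>\<omega>. (real (demand I i \<omega>), real (Y \<omega>))) -` ({real x} \<times> {real r<..}) \<inter> space ?M =
        {\<omega> \<in> space ?M. demand I i \<omega> = x \<and> r < Y \<omega>}"
      "(\<lambda>\<omega>. real (demand I i \<omega>)) -` {real x} \<inter> space ?M = {\<omega> \<in> space ?M. demand I i \<omega> = x}"
      "(\<lambda>\<omega>. real (Y \<omega>)) -` {real r<..} \<inter> space ?M = {\<omega> \<in> space ?M. r < Y \<omega>}"
      by auto
    ultimately show ?thesis by simp
  qed
  \<comment> \<open>As x \<le> q, the difference q - x is not truncated. The events
    \<open>?B x\<close> are disjoint because they fix different demands of \<open>i\<close>.\<close>
  let ?B = "\<lambda>x. {\<omega> \<in> space ?M. demand I i \<omega> = x \<and> q - x < Y \<omega>}"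
  have "{\<omega> \<in> space ?M. q < (\<Sum>j\<in>insert i A. demand I j \<omega>)} =
      {\<omega> \<in> space ?M. q < demand I i \<omega>} \<union> (\<Union>x\<in>{..q}. ?B x)"
    using assms by (auto simp: Y_def)
  moreover have "prob ({\<omega> \<in> space ?M. q < demand I i \<omega>} \<union> (\<Union>x\<in>{..q}. ?B x)) =
      prob {\<omega> \<in> space ?M. q < demand I i \<omega>} + prob (\<Union>x\<in>{..q}. ?B x)"
    by (rule finite_measure_Union) auto
  moreover have "prob (\<Union>x\<in>{..q}. ?B x) = (\<Sum>x\<le>q. prob (?B x))"
    by (rule finite_measure_finite_Union) (auto simp: disjoint_family_on_def)
  ultimately show ?thesis by (simp add: prod[unfolded Y_def] Y_def)
qed

text \<open>\<open>f\<close> can be arbitrary: it is only evaluated at loads in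
  \<open>{0..int (cap I)}\<close>, where it is bounded by \<open>B\<close>, and every function on a
  discrete space is measurable. The integrand is dominated by \<bar>c\<bar> times the demand plus
  \<open>B\<close>.\<close>

lemma integrable_recourse:
  assumes "i \<in> customers I" and "q \<le> cap I"
  shows "integrable (pspace I) (\<lambda>\<omega>. c * real_of_int (Psi (cap I) (int (demand I i \<omega>)) (int q))
    + f (Psi (cap I) (int (demand I i \<omega>)) (int q) * int (cap I) + int q - int (demand I i \<omega>)))"
proof -
  let ?h = "\<lambda>x::nat. c * real_of_int (Psi (cap I) (int x) (int q))
    + f (Psi (cap I) (int x) (int q) * int (cap I) + int q - int x)"
  define B where "B = Max ((\<lambda>z. \<bar>f z\<bar>) ` {0..int (cap I)})"
  have bound: "\<bar>?h x\<bar> \<le> \<bar>c\<bar> * real x + B" for x :: nat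
  proof -
    have "\<bar>f (Psi (cap I) (int x) (int q) * int (cap I) + int q - int x)\<bar> \<le> B"
      unfolding B_def using restocked_load_bounds[of "int q" "cap I" "int x"] assms cap_pos
      by (intro Max_ge imageI) auto
    moreover have "real_of_int (Psi (cap I) (int x) (int q)) \<le> real x"
      using Psi_le[of "int q" "int x" "cap I"] cap_pos by linarith
    then have "\<bar>c * real_of_int (Psi (cap I) (int x) (int q))\<bar> \<le> \<bar>c\<bar> * real x"
      using Psi_nonneg[of "cap I" "int x" "int q"] by (simp add: abs_mult mult_left_mono)
    ultimately show ?thesis by linarith
  qed
  have [measurable]: "demand I i \<in> pspace I \<rightarrow>\<^sub>M count_space UNIV"
    using assms demand_measurable by simp
  have "?h \<in> borel_measurable (count_space UNIV)" by simp
  then have meas: "(\<lambda>\<omega>. ?h (demand I i \<omega>)) \<in> borel_measurable (pspace I)" by measurable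
  have "integrable (pspace I) (\<lambda>\<omega>. \<bar>c\<bar> * real (demand I i \<omega>) + B)"
    using demand_integrable[OF assms(1)] by simp
  then show ?thesis
    by (rule Bochner_Integration.integrable_bound[OF _ meas]) (use bound order_trans[OF bound abs_ge_self] in \<open>simp only: real_norm_def AE_I2\<close>)
qed

section \<open>Recourse cost of a single path\<close>

text \<open>If the demand on the path exceeds the load, the vehicle must fail or restock
  preventively somewhere, and either costs at least \<open>C\<close>. The induction runs over all
  loads at once, since the load changes along the path.\<close>

lemma H_OR_ge_overflow:
  assumes "distinct p" and "set p \<subseteq> customers I" and "0 \<le> C"
    and "\<And>i. i \<in> set p \<Longrightarrow> C \<le> cF I i"
    and "successively (\<lambda>i j. C \<le> cP I i j) p"
    and "q \<le> cap I"
  shows "C * prob {\<omega> \<in> space (pspace I). q < (\<Sum>i\<in>set p. demand I i \<omega>)} \<le> H_OR I p (int q)"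
  using assms
proof (induction p arbitrary: q)
  case Nil
  then show ?case by simp
next
  case (Cons i p)
  let ?M = "pspace I"
  let ?P = "\<lambda>r. prob {\<omega> \<in> space ?M. r < (\<Sum>j\<in>set p. demand I j \<omega>)}"
  let ?X = "demand I i"
  let ?psi = "\<lambda>\<omega>. Psi (cap I) (int (?X \<omega>)) (int q)"
  let ?f = "\<lambda>\<omega>. cF I i * real_of_int (?psi \<omega>) + F_OR I (i # p) (?psi \<omega> * int (cap I) + int q - int (?X \<omega>))"
  \<comment> \<open>\<open>?g\<close> charges \<open>C\<close> for a failure at \<open>i\<close>,
    and otherwise \<open>C\<close> times the overflow probability of the rest from the remaining
    load. By \<open>overflow_split\<close> its integral is the left-hand side of the claim.\<close>
  let ?g = "\<lambda>\<omega>. C * (indicator {\<omega> \<in> space ?M. q < ?X \<omega>} \<omega> +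
              (\<Sum>x\<le>q. indicator {\<omega> \<in> space ?M. ?X \<omega> = x} \<omega> * ?P (q - x)))"
  have i: "i \<in> customers I" using Cons.prems by simp
  have IH: "C * ?P r \<le> H_OR I p (int r)" if "r \<le> cap I" for r
    by (rule Cons.IH) (use Cons.prems that in \<open>auto simp: successively_Cons\<close>)
  \<comment> \<open>Continuing without restocking is covered by \<open>IH\<close>; restocking costs
    at least \<open>C\<close>, which suffices as probabilities are at most 1. After the last
    customer the sum is empty and \<open>?P r\<close> is 0.\<close>
  have F: "C * ?P r \<le> F_OR I (i # p) (int r)" if "r \<le> cap I" for r
  proof (cases p)
    case Nil
    then show ?thesis by simp
  next
    case (Cons j p')
    have "C * ?P r \<le> C * 1" using \<open>0 \<le> C\<close> by (intro mult_left_mono) auto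
    also have "\<dots> \<le> cP I i j" using Cons.prems Cons by simp
    also have "\<dots> \<le> cP I i j + H_OR I p (int (cap I))"
      using IH[of "cap I"] \<open>0 \<le> C\<close> by (smt (verit) measure_nonneg mult_nonneg_nonneg order_refl)
    finally show ?thesis using IH[OF that] Cons by simp
  qed
  \<comment> \<open>Without a failure only the summand at the actual demand survives; with a failure
    all summands vanish and the failure cost alone covers \<open>C\<close>.\<close>
  have le: "?g \<omega> \<le> ?f \<omega>" if \<omega>: "\<omega> \<in> space ?M" for \<omega>
  proof (cases "?X \<omega> \<le> q")
    case True
    have "(\<Sum>x\<le>q. indicator {\<omega> \<in> space ?M. ?X \<omega> = x} \<omega> * ?P (q - x)) =
        (\<Sum>x\<le>q. if x = ?X \<omega> then ?P (q - x) else 0)"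
      using \<omega> by (intro sum.cong) (auto simp: indicator_def)
    also have "\<dots> = ?P (q - ?X \<omega>)" using True by simp
    finally have sum: "(\<Sum>x\<le>q. indicator {\<omega> \<in> space ?M. ?X \<omega> = x} \<omega> * ?P (q - x)) =
        ?P (q - ?X \<omega>)" .
    have "?g \<omega> = C * ?P (q - ?X \<omega>)" unfolding sum using True by simp
    also have "\<dots> \<le> F_OR I (i # p) (int (q - ?X \<omega>))"
      using F[of "q - ?X \<omega>"] Cons.prems by simp
    also have "\<dots> = ?f \<omega>" using True by (simp add: Psi_eq_0 of_nat_diff)
    finally show ?thesis .
  next
    case False
    have sum: "(\<Sum>x\<le>q. indicator {\<omega> \<in> space ?M. ?X \<omega> = x} \<omega> * ?P (q - x)) = 0"
      using False by (intro sum.neutral) (auto simp: indicator_def)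
    have "?g \<omega> = C" unfolding sum using False \<omega> by simp
    also have "C \<le> cF I i * 1" using Cons.prems by simp
    also have "\<dots> \<le> cF I i * real_of_int (?psi \<omega>)"
      using cF_nonneg[OF i] Psi_ge_1[of "int q" "int (?X \<omega>)" "cap I"] False cap_pos
      by (intro mult_left_mono) auto
    \<comment> \<open>The cost-to-go is nonnegative, because \<open>F\<close> bounds it from below
      at the refilled load.\<close>
    also have "\<dots> \<le> ?f \<omega>"
    proof -
      obtain r where r: "r \<le> cap I" "?psi \<omega> * int (cap I) + int q - int (?X \<omega>) = int r"
        using restocked_load_bounds[of "int q" "cap I" "int (?X \<omega>)"] Cons.prems cap_pos
        by (metis atLeastAtMost_iff of_nat_0_le_iff of_nat_le_iff zero_le_imp_eq_int)
      have "0 \<le> C * ?P r" using \<open>0 \<le> C\<close> by simp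
      with F[OF r(1)] show ?thesis unfolding r(2) by simp
    qed
    finally show ?thesis .
  qed
  have [measurable]: "?X \<in> ?M \<rightarrow>\<^sub>M count_space UNIV" using i demand_measurable by simp
  have ind: "integrable ?M (indicator B :: 'a \<Rightarrow> real)" if "B \<in> sets ?M" for B
    using that by (intro integrable_real_indicator) (auto simp: less_top[symmetric])
  have int1: "integrable ?M (indicator {\<omega> \<in> space ?M. q < ?X \<omega>} :: 'a \<Rightarrow> real)"
    by (rule ind) measurable
  have int2: "integrable ?M (\<lambda>\<omega>. indicator {\<omega> \<in> space ?M. ?X \<omega> = x} \<omega> * ?P (q - x))" for x
    by (intro integrable_mult_left ind) measurable
  have int_g: "integrable ?M ?g"
    by (intro integrable_mult_right Bochner_Integration.integrable_add
        Bochner_Integration.integrable_sum int1 int2)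
  have "(\<integral>\<omega>. ?g \<omega> \<partial>?M) = C * (prob {\<omega> \<in> space ?M. q < ?X \<omega>} +
      (\<Sum>x\<le>q. prob {\<omega> \<in> space ?M. ?X \<omega> = x} * ?P (q - x)))"
    by (subst integral_mult_right_zero, subst Bochner_Integration.integral_add[OF int1],
        (intro Bochner_Integration.integrable_sum int2),
        subst Bochner_Integration.integral_sum[OF int2])
       (simp del: sum_mult_indicator sum_indicator_mult)
  also have "\<dots> = C * prob {\<omega> \<in> space ?M. q < (\<Sum>j\<in>set (i # p). demand I j \<omega>)}"
    using overflow_split[of i "set p" q] Cons.prems by simp
  finally have "C * prob {\<omega> \<in> space ?M. q < (\<Sum>j\<in>set (i # p). demand I j \<omega>)} = (\<integral>\<omega>. ?g \<omega> \<partial>?M)" ..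
  also have "\<dots> \<le> (\<integral>\<omega>. ?f \<omega> \<partial>?M)"
    by (rule integral_mono[OF int_g integrable_recourse]) (use i le Cons.prems in auto)
  finally show ?case by simp
qed

lemma recourse_OR_ge_overflow:
  assumes "feasible_path I p" and "0 \<le> C"
    and "\<And>i. i \<in> set p \<Longrightarrow> C \<le> cF I i"
    and "\<And>i j. {i, j} \<in> path_edges p \<Longrightarrow> C \<le> cP I i j"
  shows "C * overflow_prob I (set p) \<le> recourse_OR I p"
proof -
  have bound: "C * overflow_prob I (set p) \<le> F_OR I (0 # p') (int (cap I))"
    if "p' \<in> {p, rev p}" for p'
  proof -
    have p': "p' \<noteq> []" "distinct p'" "set p' = set p" "set p' \<subseteq> customers I"
      using that assms(1) by (auto simp: feasible_path_def)
    \<comment> \<open>Edges are unordered, so the bound holds in both directions and carries over to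
      the reversed path.\<close>
    have "successively (\<lambda>i j. C \<le> cP I i j \<and> C \<le> cP I j i) p"
      unfolding successively_conv_nth
    proof (intro allI impI)
      fix k assume "Suc k < length p"
      then have "{p ! k, p ! Suc k} \<in> path_edges p" by (auto simp: path_edges_def)
      then show "C \<le> cP I (p ! k) (p ! Suc k) \<and> C \<le> cP I (p ! Suc k) (p ! k)"
        using assms(4) by (metis insert_commute)
    qed
    then have succ: "successively (\<lambda>i j. C \<le> cP I i j) p'"
      using that by (auto simp: successively_rev elim: successively_mono)
    have "C * overflow_prob I (set p) \<le> H_OR I p' (int (cap I))"
      unfolding overflow_prob_def p'(3)[symmetric]
      by (rule H_OR_ge_overflow) (use p' assms succ in auto)
    \<comment> \<open>The vehicle leaves the depot full, so restocking there only adds the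
      nonnegative \<open>penP I\<close>.\<close>
    then show ?thesis using p'(1) penP_nonneg by (cases p') (auto simp: cP_def)
  qed
  then show ?thesis by (simp add: recourse_OR_def)
qed

section \<open>From partitions to assignments\<close>

lemma L1_le_partition_recourse:
  assumes S: "S \<subseteq> customers I" and E: "E \<subseteq> all_edges_on S"
    and idx: "bij_betw idx {1..card S} S"
    and u: "mean_unit I S u" and \<rho>: "overflow_bound I S u \<rho>"
    and part: "\<pi> \<in> path_partitions_E I S E m"
  shows "L1 I S E m idx u \<rho> \<le> ereal (\<Sum>p\<in>\<pi>. recourse_OR I p)"
proof -
  have fin: "finite \<pi>" and card: "card \<pi> = m" and feas: "\<And>p. p \<in> \<pi> \<Longrightarrow> feasible_path I p"
    and disj: "disjoint_family_on set \<pi>" and union: "(\<Union>p\<in>\<pi>. set p) = S"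
    and edges: "\<And>p. p \<in> \<pi> \<Longrightarrow> path_edges p \<subseteq> E"
    using part by (auto simp: path_partitions_E_def path_partitions_def)
  define pos where "pos = inv_into {1..card S} idx"
  have pos: "pos i \<in> {1..card S}" "idx (pos i) = i" if "i \<in> S" for i
    using that idx by (auto simp: pos_def bij_betw_def intro: f_inv_into_f)
       (metis atLeastAtMost_iff inv_into_into)+
  \<comment> \<open>The smallest index on \<open>p\<close>. It is attained since paths are nonempty,
    and disjoint paths have different ones.\<close>
  define a where "a p = Min (pos ` set p)" for p
  have a_mem: "a p \<in> pos ` set p" if "p \<in> \<pi>" for p
    using feas[OF that] unfolding a_def by (intro Min_in) (auto simp: feasible_path_def)
  have a_le: "a p \<le> pos i" if "i \<in> set p" for p i
    using that by (simp add: a_def)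
  have inj: "inj_on a \<pi>"
  proof (rule inj_onI)
    fix p p' assume p: "p \<in> \<pi>" "p' \<in> \<pi>" "a p = a p'"
    obtain i j where "i \<in> set p" "j \<in> set p'" "pos i = pos j"
      using a_mem[OF p(1)] a_mem[OF p(2)] p(3) by auto
    moreover from this have "i = j" using pos(2) union p by (metis UN_I)
    ultimately show "p = p'" using disj p by (auto simp: disjoint_family_on_def)
  qed
  have a_ge: "1 \<le> a p" if "p \<in> \<pi>" for p
    using a_mem[OF that] pos(1) union that by fastforce
  obtain e where e: "bij_betw e {1..m} \<pi>" and rank: "\<And>k. k \<in> {1..m} \<Longrightarrow> k \<le> a (e k)"
    using ex_bij_betw_rank_le[of \<pi> a, OF fin inj a_ge] card by auto
  have e_mem: "e k \<in> \<pi>" if "k \<in> {1..m}" for k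
    using bij_betwE[OF e] that by blast
  have u0: "0 < u" using u by (simp add: mean_unit_def)
  \<comment> \<open>Means are nonnegative, so the integer multiples of \<open>u\<close> are natural
    ones.\<close>
  have "\<exists>n. mean I i = real n * u" if "i \<in> S" for i
  proof -
    obtain z where z: "mean I i = of_int z * u" using u \<open>i \<in> S\<close> unfolding mean_unit_def by blast
    then have "0 \<le> z" using mean_nonneg[of i] u0 by (simp add: zero_le_mult_iff)
    then show ?thesis using z by (metis of_int_of_nat_eq zero_le_imp_eq_int)
  qed
  then obtain w where w: "\<And>i. i \<in> S \<Longrightarrow> mean I i = real (w i) * u" by metis
  \<comment> \<open>The mean demand of the \<open>k\<close>-th path in units of \<open>u\<close>;
    path feasibility keeps it within \<open>max_units I u\<close>.\<close>
  define len where "len k = (\<Sum>i\<in>set (e k). w i)" for k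
  have sub: "set (e k) \<subseteq> S" if "k \<in> {1..m}" for k
    using union e_mem[OF that] by auto
  have len: "(\<Sum>i\<in>set (e k). mean I i) = real (len k) * u" if "k \<in> {1..m}" for k
    using w sub[OF that] by (auto simp: len_def sum_distrib_right intro!: sum.cong)
  have len_le: "len k \<le> max_units I u" if "k \<in> {1..m}" for k
  proof -
    have "real (len k) * u \<le> load I * real (cap I)"
      using feas[OF e_mem[OF that]] len[OF that] by (simp add: feasible_path_def)
    then have "real (len k) \<le> load I * real (cap I) / u" using u0 by (simp add: le_divide_eq)
    then show ?thesis unfolding max_units_def by linarith
  qed
  define y :: "nat \<Rightarrow> nat \<Rightarrow> nat" where "y k l = (if l = len k then 1 else 0)" for k l
  have pick: "(\<Sum>l=0..max_units I u. l * y k l) = len k" if "k \<in> {1..m}" for k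
  proof -
    have "(\<Sum>l=0..max_units I u. l * y k l) = (\<Sum>l=0..max_units I u. if l = len k then l else 0)"
      by (intro sum.cong) (auto simp: y_def)
    then show ?thesis using len_le[OF that] by simp
  qed
  \<comment> \<open>The paths are disjoint with union \<open>S\<close>, so their levels
    \<open>len k\<close> add up to the total required of an assignment.\<close>
  have "(\<Sum>i\<in>S. mean I i) = (\<Sum>p\<in>\<pi>. \<Sum>i\<in>set p. mean I i)"
    unfolding union[symmetric] using fin disj
    by (intro sum.UNION_disjoint) (auto simp: disjoint_family_on_def)
  also have "\<dots> = (\<Sum>k=1..m. \<Sum>i\<in>set (e k). mean I i)"
    using sum.reindex_bij_betw[OF e, of "\<lambda>p. \<Sum>i\<in>set p. mean I i"] by simp
  also have "\<dots> = (\<Sum>k=1..m. real (len k)) * u"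
    using len by (simp add: sum_distrib_right)
  finally have "total_units I S u = (\<Sum>k=1..m. real (len k))"
    using u0 by (simp add: total_units_def)
  moreover have "real (\<Sum>k=1..m. \<Sum>l=0..max_units I u. l * y k l) = (\<Sum>k=1..m. real (len k))"
    using pick by simp
  moreover have "(\<Sum>l=0..max_units I u. y k l) = 1" if "k \<in> {1..m}" for k
    using len_le[OF that] by (simp add: y_def)
  ultimately have "y \<in> assignments I S m u"
    by (auto simp: assignments_def y_def)
  then have "L1 I S E m idx u \<rho> \<le> (\<Sum>k=1..m. \<Sum>l=0..max_units I u.
      (ereal (\<rho> (real l * u)) * cR_from I S E idx k) * ereal (real (y k l)))"
    unfolding L1_def by (rule INF_lower)
  also have "\<dots> \<le> (\<Sum>k=1..m. ereal (recourse_OR I (e k)))"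
  proof (rule sum_mono)
    fix k assume k: "k \<in> {1..m}"
    let ?p = "e k"
    have p: "?p \<in> \<pi>" using e_mem[OF k] .
    have pos_ge: "pos i \<in> {k..card S}" "idx (pos i) = i" if "i \<in> set ?p" for i
      using rank[OF k] a_le[OF that] pos[of i] sub[OF k] that by auto
    have cust: "idx j \<in> customers I" if "j \<in> {k..card S}" for j
      using bij_betwE[OF idx] that k S by auto
    let ?c = "cR_from I S E idx k"
    \<comment> \<open>An infimum in \<open>ereal\<close> may be infinite. Here \<open>?c\<close> is
      a real \<open>C\<close>: it is nonnegative, and at most \<open>cF I i\<close> for any
      \<open>i\<close> on the nonempty path, even if no edge of \<open>E\<close> remains.\<close>
    have "0 \<le> ?c"
      unfolding cR_from_def cF_from_def cP_from_def
    proof (intro min.boundedI INF_greatest)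
      fix j assume "j \<in> {k..card S}"
      then show "0 \<le> ereal (cF I (idx j))" using cF_nonneg cust by simp
    next
      fix x assume "x \<in> {(j, l). j \<in> {k..card S} \<and> l \<in> {k..card S} \<and> {idx j, idx l} \<in> E}"
      then obtain j l where x: "x = (j, l)" "j \<in> {k..card S}" "l \<in> {k..card S}" "{idx j, idx l} \<in> E"
        by auto
      \<comment> \<open>\<open>E\<close> contains no loops, as required by
        \<open>cP_nonneg\<close>.\<close>
      then have "idx j \<noteq> idx l" using E by (fastforce simp: all_edges_on_def doubleton_eq_iff)
      then have "0 \<le> cP I (idx j) (idx l)" using x cust by (intro cP_nonneg) auto
      then show "0 \<le> (case x of (j, l) \<Rightarrow> ereal (cP I (idx j) (idx l)))" using x by simp
    qed
    moreover have cF: "?c \<le> ereal (cF I i)" if "i \<in> set ?p" for i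
    proof -
      have "cF_from I S idx k \<le> ereal (cF I (idx (pos i)))"
        unfolding cF_from_def using pos_ge[OF that] by (intro INF_lower)
      then show ?thesis using pos_ge[OF that] by (simp add: cR_from_def min.coboundedI1)
    qed
    moreover obtain i where "i \<in> set ?p" using feas[OF p] by (fastforce simp: feasible_path_def)
    ultimately obtain C where C: "?c = ereal C" "0 \<le> C"
      by (cases ?c) force+
    have cP: "?c \<le> ereal (cP I i j)" if "{i, j} \<in> path_edges ?p" for i j
    proof -
      have "{i, j} \<subseteq> set ?p" using that by (force simp: path_edges_def)
      then have ij: "i \<in> set ?p" "j \<in> set ?p" by auto
      \<comment> \<open>Both ends have index at least \<open>k\<close> and the edge lies in
        \<open>E\<close>, so this pair takes part in the minimum.\<close>
      have "cP_from I S E idx k \<le> (case (pos i, pos j) of (j, l) \<Rightarrow> ereal (cP I (idx j) (idx l)))"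
        unfolding cP_from_def using pos_ge[OF ij(1)] pos_ge[OF ij(2)] that edges[OF p]
        by (intro INF_lower) auto
      then show ?thesis
        using pos_ge[OF ij(1)] pos_ge[OF ij(2)] by (simp add: cR_from_def min.coboundedI2)
    qed
    \<comment> \<open>The customers of the path form a subset of \<open>S\<close> with total mean
      \<open>real (len k) * u\<close>, one of those that bound \<rho> at this level.\<close>
    have "\<rho> (real (len k) * u) \<le> overflow_prob I (set ?p)"
      using \<rho> len_le[OF k] sub[OF k] len[OF k] by (auto simp: overflow_bound_def)
    then have "\<rho> (real (len k) * u) * C \<le> C * overflow_prob I (set ?p)"
      using C by (metis mult.commute mult_left_mono)
    also have "\<dots> \<le> recourse_OR I ?p"
      by (rule recourse_OR_ge_overflow[OF feas[OF p]]) (use C cF cP in auto)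
    finally have le: "\<rho> (real (len k) * u) * C \<le> recourse_OR I ?p" .
    have "(\<Sum>l=0..max_units I u. (ereal (\<rho> (real l * u)) * ?c) * ereal (real (y k l))) =
        (\<Sum>l=0..max_units I u. if l = len k then ereal (\<rho> (real l * u)) * ?c else 0)"
      by (intro sum.cong) (auto simp: y_def zero_ereal_def[symmetric] one_ereal_def[symmetric])
    also have "\<dots> = ereal (\<rho> (real (len k) * u) * C)" using len_le[OF k] C by simp
    finally show "(\<Sum>l=0..max_units I u. (ereal (\<rho> (real l * u)) * ?c) * ereal (real (y k l)))
        \<le> ereal (recourse_OR I ?p)" using le by simp
  qed
  also have "\<dots> = ereal (\<Sum>p\<in>\<pi>. recourse_OR I p)"
    using sum.reindex_bij_betw[OF e, of "recourse_OR I"] by simp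
  finally show ?thesis .
qed

end

section \<open>The complete edge set and the S-cut\<close>

text \<open>Consecutive customers of a path are distinct elements of \<open>S\<close>, so the
  restriction to \<open>all_edges_on S\<close> is vacuous. This makes the S-cut a case of the
  E-cut.\<close>

lemma path_partitions_E_all_edges:
  "path_partitions_E I S (all_edges_on S) m = path_partitions I S m"
proof -
  have "path_edges p \<subseteq> all_edges_on S" if "\<pi> \<in> path_partitions I S m" "p \<in> \<pi>" for \<pi> p
  proof -
    have "distinct p" "set p \<subseteq> S"
      using that by (auto simp: path_partitions_def feasible_path_def)
    show ?thesis
    proof
      fix x assume "x \<in> path_edges p"
      then obtain j where j: "x = {p ! j, p ! Suc j}" "Suc j < length p"
        by (auto simp: path_edges_def)
      then have "p ! j \<noteq> p ! Suc j" "p ! j \<in> S" "p ! Suc j \<in> S"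
        using \<open>distinct p\<close> \<open>set p \<subseteq> S\<close> nth_mem[of j p] nth_mem[of "Suc j" p]
        by (auto simp: nth_eq_iff_index_eq)
      then show "x \<in> all_edges_on S" using j by (auto simp: all_edges_on_def)
    qed
  qed
  then show ?thesis by (auto simp: path_partitions_E_def)
qed

theorem proposition5:
  fixes I :: "'a vrpsd" and S :: "nat set" and idx :: "nat \<Rightarrow> nat"
    and u :: real and \<rho> :: "real \<Rightarrow> real"
  assumes "vrpsd_instance I"
    and "S \<subseteq> customers I" and "S \<noteq> {}"
    and "bij_betw idx {1..card S} S"
    and "mean_unit I S u"
    and "overflow_bound I S u \<rho>"
  shows "(\<forall>E m. E \<subseteq> all_edges_on S \<and> 1 \<le> m \<and> enat m \<le> min_paths_E I S E \<longrightarrow>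
            L1 I S E m idx u \<rho> \<le> min_recourse_E I S E m \<and>
            valid_E_cut_coeff I S E m (L1 I S E m idx u \<rho>)) \<and>
         (\<forall>m. 1 \<le> m \<and> enat m \<le> min_paths I S \<longrightarrow>
            L1 I S (all_edges_on S) m idx u \<rho> \<le> min_recourse I S m \<and>
            valid_S_cut_coeff I S m (L1 I S (all_edges_on S) m idx u \<rho>))"
proof -
  interpret vrpsd_instance I by fact
  \<comment> \<open>The right-hand side is an infimum, so it suffices to bound each partition;
    without partitions it is \<infinity>.\<close>
  have E: "L1 I S E m idx u \<rho> \<le> min_recourse_E I S E m" if "E \<subseteq> all_edges_on S" for E m
    unfolding min_recourse_E_def
    by (rule INF_greatest, rule L1_le_partition_recourse) (use assms that in auto)
  then have "L1 I S (all_edges_on S) m idx u \<rho> \<le> min_recourse I S m" for m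
    by (metis min_recourse_E_def min_recourse_def order_refl path_partitions_E_all_edges)
  with E show ?thesis by (simp add: valid_E_cut_coeff_def valid_S_cut_coeff_def)
qed

end
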